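(* Let $\omega=\{0,1,2,\dots\}$ and define a metric $\rho'$ on $\omega$ by $\rho'(n,n)=0$ and $\rho'(n,m)=\max\{n,m\}$ for $n\neq m$. Define a metric $\rho$ on $\omega\times\omega$ by $\rho((n,m),(n',m'))=\max\{\rho'(n,n'),\rho'(m,m')\}$, and let $W_2$ be the subspace $$W_2=\{(n,0):n\in\omega\}\cup\{(n,m):n>m>0\}$$ of $(\omega\times\omega,\rho)$. Let $(X,d)$ be a metric space (with integer valued metric). Then $(X,d)$ is asymptotically scattered if and only if no subspace of $(X,d)$ is asymorphic to $W_2$.
   Context: All metrics are supposed to take values in $\omega=\{0,1,2,\dots\}$. For a metric space $(X,d)$, $x\in X$, $m\in\omega$, put $B(x,m)=\{y\in X:d(x,y)\le m\}$. A subset $V\subseteq X$ is bounded if $V\subseteq B(x_0,n)$ for some $x_0\in X$, $n\in\omega$. A subset $Y\subseteq X$ has asymptotically isolated balls (in $X$) if there exist $m\in\omega$, a sequence $(y_n)_{n\in\omega}$ in $Y$ and a strictly increasing sequence $(m_n)_{n\in\omega}$ in $\omega$ with $m_0>m$ such that $B(y_n,m_n)\setminus B(y_n,m)=\varnothing$ for each $n\in\omega$ (the balls are taken in $X$). The metric space $(X,d)$ is asymptotically scattered if each unbounded subset of $X$ has asymptotically isolated balls. For metric spaces $(X_1,d_1)$, $(X_2,d_2)$, a bijection $f:X_1\to X_2$ is an asymorphism if there are sequences $(c_n)_{n\in\omega}$, $(c_n')_{n\in\omega}$ in $\omega$ such that for all $n\in\omega$ and $x,y\in X_1$: $d_1(x,y)\le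 n\Rightarrow d_2(f(x),f(y))<c_n$, and $d_2(f(x),f(y))\le n\Rightarrow d_1(x,y)<c_n'$. Two spaces are asymorphic if there is an asymorphism between them. A subspace is a subset with the restricted metric. *)

theory Defs
  imports "HOL-Analysis.Analysis"
begin

locale nat_metric_space = Metric_space M "\<lambda>x y. real (d x y)"
  for M :: "'a set" and d :: "'a \<Rightarrow> 'a \<Rightarrow> nat"
begin

text \<open>
  Balls are taken in the whole carrier \<^term>\<open>M\<close>, not in \<^term>\<open>Y\<close>.
\<close>

definition has_asymptotically_isolated_balls :: "'a set \<Rightarrow> bool" where
  "has_asymptotically_isolated_balls Y \<longleftrightarrow>
     (\<exists>(m::nat) (y :: nat \<Rightarrow> 'a) (r :: nat \<Rightarrow> nat).
        range y \<subseteq> Y \<and> strict_mono r \<and> r 0 > m \<and>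
        (\<forall>n. mcball (y n) (real (r n)) - mcball (y n) (real m) = {}))"

text \<open>
  The library's \<^term>\<open>mbounded\<close> does not require the centre of the ball to lie in
  \<^term>\<open>M\<close>. This only makes a difference for the empty space, whose empty subset
  counts as bounded, so that the empty space is asymptotically scattered.
\<close>

definition asymptotically_scattered :: bool where
  "asymptotically_scattered \<longleftrightarrow>
     (\<forall>Y\<subseteq>M. \<not> mbounded Y \<longrightarrow> has_asymptotically_isolated_balls Y)"

end

definition asymorphism ::
  "'a set \<Rightarrow> ('a \<Rightarrow> 'a \<Rightarrow> nat) \<Rightarrow> 'b set \<Rightarrow> ('b \<Rightarrow> 'b \<Rightarrow> nat) \<Rightarrow> ('a \<Rightarrow> 'b) \<Rightarrow> bool" where
  "asymorphism X1 d1 X2 d2 f \<longleftrightarrow>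
     bij_betw f X1 X2 \<and>
     (\<exists>(c :: nat \<Rightarrow> nat) (c' :: nat \<Rightarrow> nat). \<forall>n. \<forall>x\<in>X1. \<forall>y\<in>X1.
        (d1 x y \<le> n \<longrightarrow> d2 (f x) (f y) < c n) \<and>
        (d2 (f x) (f y) \<le> n \<longrightarrow> d1 x y < c' n))"

definition asymorphic ::
  "'a set \<Rightarrow> ('a \<Rightarrow> 'a \<Rightarrow> nat) \<Rightarrow> 'b set \<Rightarrow> ('b \<Rightarrow> 'b \<Rightarrow> nat) \<Rightarrow> bool" where
  "asymorphic X1 d1 X2 d2 \<longleftrightarrow> (\<exists>f. asymorphism X1 d1 X2 d2 f)"

definition rho' :: "nat \<Rightarrow> nat \<Rightarrow> nat" where
  "rho' n m = (if n = m then 0 else max n m)"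

definition rho :: "nat \<times> nat \<Rightarrow> nat \<times> nat \<Rightarrow> nat" where
  "rho p q = max (rho' (fst p) (fst q)) (rho' (snd p) (snd q))"

definition W2 :: "(nat \<times> nat) set" where
  "W2 = {(n, 0) | n. True} \<union> {(n, m) | n m. n > m \<and> m > 0}"

lemma nat_metric_space_rho': "nat_metric_space UNIV rho'"
  by unfold_locales (auto simp: rho'_def)

lemma nat_metric_space_rho: "nat_metric_space UNIV rho"
proof -
  have tri: "rho' a c \<le> rho' a b + rho' b c" for a b c
    by (auto simp: rho'_def)
  show ?thesis
  proof unfold_locales
    fix x y z :: "nat \<times> nat"
    have "rho x z \<le> rho x y + rho y z"
      using tri[of "fst x" "fst z" "fst y"] tri[of "snd x" "snd z" "snd y"]
      unfolding rho_def by linarith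
    then show "real (rho x z) \<le> real (rho x y) + real (rho y z)"
      by linarith
  qed (auto simp: rho_def rho'_def prod_eq_iff)
qed

lemma nat_metric_space_W2: "nat_metric_space W2 rho"
proof -
  interpret nat_metric_space UNIV rho by (rule nat_metric_space_rho)
  show ?thesis
    unfolding nat_metric_space_def by (rule subspace) simp
qed

end

theory Submission
  imports Defs
begin

text \<open>
  \<^term>\<open>W2\<close> is a union of columns \<open>{(n, j) | j < n}\<close>, where distances inside a column are
  \<^term>\<open>max i j\<close> and the distance between different columns is the larger column index. In the
  image of the row \<open>{(n, 0)}\<close> no ball can be isolated, since at every scale each column (or a
  neighbouring one) provides a point. Conversely, if \<open>Y\<close> is unbounded without asymptotically
  isolated balls, then every annulus \<open>m < d y x \<le> g m\<close> around every \<open>y \<in> Y\<close> is nonempty. Choosing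
  points in rapidly growing annuli around a sparse sequence in \<open>Y\<close> produces a copy of
  \<^term>\<open>W2\<close>.
\<close>

section \<open>Distances in \<open>W2\<close> and a criterion for asymorphy\<close>

lemma W2_iff: "(n, m) \<in> W2 \<longleftrightarrow> m = 0 \<or> m < n"
  by (auto simp: W2_def)

lemma rho_same_column: "rho (n, i) (n, j) = rho' i j"
  by (simp add: rho_def rho'_def)

text \<open>In \<open>W2\<close> a second coordinate never exceeds the first, so the second
  component of \<open>rho\<close> is at most \<open>max n k\<close>.\<close>

lemma rho_distinct_columns:
  assumes "(n, i) \<in> W2" "(k, j) \<in> W2" "n \<noteq> k"
  shows "rho (n, i) (k, j) = max n k"
  using assms by (auto simp: W2_iff rho_def rho'_def)

text \<open>The inverse of \<open>h\<close> is the asymorphism. Monotonicity of \<open>C\<close>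
  turns the bound at the exact distance \<open>e p q\<close> into one for all pairs at distance at
  most \<open>n\<close>; \<open>Suc\<close> makes both bounds strict.\<close>

lemma asymorphicI:
  assumes lower: "\<And>p q. p \<in> B \<Longrightarrow> q \<in> B \<Longrightarrow> e p q \<le> d (h p) (h q)"
    and upper: "\<And>p q. p \<in> B \<Longrightarrow> q \<in> B \<Longrightarrow> d (h p) (h q) \<le> C (e p q)"
    and "mono C"
    and inj: "inj_on h B"
  shows "asymorphic (h ` B) d B e"
proof -
  let ?f = "the_inv_into B h"
  have f: "?f (h p) = p" if "p \<in> B" for p
    using that inj by (rule the_inv_into_f_f[rotated])
  have "bij_betw ?f (h ` B) B"
    using inj by (simp add: bij_betw_the_inv_into inj_on_imp_bij_betw)
  moreover have "e p q < Suc n" if "p \<in> B" "q \<in> B" "d (h p) (h q) \<le> n" for n p q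
    using lower[of p q] that by simp
  moreover have "d (h p) (h q) < Suc (C n)" if "p \<in> B" "q \<in> B" "e p q \<le> n" for n p q
    using upper[of p q] monoD[OF \<open>mono C\<close> that(3)] that by simp
  ultimately have "asymorphism (h ` B) d B e ?f"
    unfolding asymorphism_def
    by (intro conjI exI[of _ Suc] exI[of _ "\<lambda>n. Suc (C n)"]) (auto simp: f)
  then show ?thesis
    unfolding asymorphic_def by blast
qed

section \<open>Integer-valued metrics and annuli\<close>

context nat_metric_space
begin

lemma nat_triangle: "x \<in> M \<Longrightarrow> y \<in> M \<Longrightarrow> z \<in> M \<Longrightarrow> d x z \<le> d x y + d y z"
  using triangle[of x y z] by linarith

lemma nat_commute: "d x y = d y x"
  using commute[of x y] by simp

lemma nat_self: "x \<in> M \<Longrightarrow> d x x = 0"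
  by (metis of_nat_eq_0_iff zero)

lemma unbounded_far_point:
  assumes "\<not> mbounded Y" "Y \<subseteq> M" "p \<in> M"
  shows "\<exists>y\<in>Y. t < d p y"
proof (rule ccontr)
  assume "\<not> ?thesis"
  then have "Y \<subseteq> mcball p (real t)"
    using assms by (auto simp: not_less)
  then show False
    using assms(1) by (auto simp: mbounded_def)
qed

text \<open>If no \<open>R\<close> worked for some \<open>m\<close>, each radius
  \<open>m + n + 1\<close> would have a centre in \<open>Y\<close> whose ball of that radius adds
  nothing to its \<open>m\<close>-ball, and these centres would witness isolated balls. The outer
  radius \<open>g m\<close> is thus uniform over \<open>Y\<close>.\<close>

lemma annuli_nonempty:
  assumes "\<not> has_asymptotically_isolated_balls Y" "Y \<subseteq> M"
  obtains g where "\<And>m. m < g m" "\<And>m y. y \<in> Y \<Longrightarrow> \<exists>x\<in>M. m < d y x \<and> d y x \<le> g m"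
proof -
  have "\<exists>R>m. \<forall>y\<in>Y. \<exists>x\<in>M. m < d y x \<and> d y x \<le> R" for m
  proof (rule ccontr)
    assume *: "\<not> ?thesis"
    have "\<exists>y\<in>Y. mcball y (real (Suc (m + n))) - mcball y (real m) = {}" for n
    proof -
      have "m < Suc (m + n)"
        by simp
      with * obtain y where "y \<in> Y" "\<forall>x\<in>M. \<not> (m < d y x \<and> d y x \<le> Suc (m + n))"
        by blast
      then have "mcball y (real (Suc (m + n))) - mcball y (real m) = {}"
        unfolding set_eq_iff Diff_iff in_mcball of_nat_le_iff by (auto simp: not_less)
      with \<open>y \<in> Y\<close> show ?thesis
        by blast
    qed
    then obtain y where "\<And>n. y n \<in> Y"
      "\<And>n. mcball (y n) (real (Suc (m + n))) - mcball (y n) (real m) = {}"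
      by metis
    then have "has_asymptotically_isolated_balls Y"
      unfolding has_asymptotically_isolated_balls_def
      by (intro exI[of _ m] exI[of _ y] exI[of _ "\<lambda>n. Suc (m + n)"])
        (auto simp: strict_mono_def)
    with assms show False
      by blast
  qed
  then show thesis
    using that by metis
qed

section \<open>Spaces containing a copy of \<open>W2\<close>\<close>

lemma not_scattered_if_W2:
  assumes "S \<subseteq> M" "asymorphic S d W2 rho"
  shows "\<not> asymptotically_scattered"
proof
  assume scat: asymptotically_scattered
  obtain f c c' where f: "bij_betw f S W2"
    and c: "\<And>n x y. x \<in> S \<Longrightarrow> y \<in> S \<Longrightarrow> d x y \<le> n \<Longrightarrow> rho (f x) (f y) < c n"
    and c': "\<And>n x y. x \<in> S \<Longrightarrow> y \<in> S \<Longrightarrow> rho (f x) (f y) \<le> n \<Longrightarrow> d x y < c' n"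
    using assms(2) unfolding asymorphic_def asymorphism_def by metis
  define h where "h = the_inv_into S f"
  have h: "h p \<in> S" "f (h p) = p" if "p \<in> W2" for p
    using f that bij_betw_imp_surj_on[OF f]
    by (auto simp: h_def bij_betw_def the_inv_into_into f_the_inv_into_f)
  have hM: "h p \<in> M" if "p \<in> W2" for p
    using h(1)[OF that] assms(1) by blast
  have far: "m < d (h p) (h q)" if "p \<in> W2" "q \<in> W2" "c m \<le> rho p q" for m p q
  proof (rule ccontr)
    assume "\<not> m < d (h p) (h q)"
    then show False
      using c[of "h p" "h q" m] h that by simp
  qed
  have near: "d (h p) (h q) < c' (rho p q)" if "p \<in> W2" "q \<in> W2" for p q
    using c'[of "h p" "h q" "rho p q"] h that by simp
  have row: "(n, 0) \<in> W2" for n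
    by (simp add: W2_iff)
  define Y where "Y = range (\<lambda>n. h (n, 0))"
  have "Y \<subseteq> M"
    using hM row by (auto simp: Y_def)
  have "\<not> mbounded Y"
  proof
    assume "mbounded Y"
    then obtain b where b: "\<And>x y. x \<in> Y \<Longrightarrow> y \<in> Y \<Longrightarrow> real (d x y) \<le> b"
      unfolding mbounded_alt by blast
    have "nat \<lceil>b\<rceil> < d (h (0, 0)) (h (Suc (c (nat \<lceil>b\<rceil>)), 0))"
      by (rule far) (auto simp: row rho_def rho'_def)
    moreover have "real (d (h (0, 0)) (h (Suc (c (nat \<lceil>b\<rceil>)), 0))) \<le> b"
      by (rule b) (auto simp: Y_def)
    ultimately show False
      by linarith
  qed
  with scat \<open>Y \<subseteq> M\<close> obtain m y r where "range y \<subseteq> Y" "strict_mono r" "r 0 > m"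
    and iso: "\<And>n::nat. mcball (y n) (real (r n)) - mcball (y n) (real m) = {}"
    unfolding asymptotically_scattered_def has_asymptotically_isolated_balls_def by metis
  \<comment> \<open>By \<open>far\<close>, points of \<open>W2\<close> at distance at least
    \<open>c m\<close> have images more than \<open>m\<close> apart. Positivity of \<open>J\<close>
    ensures that \<open>(k, J)\<close> differs from \<open>(k, 0)\<close>.\<close>
  define J where "J = c m"
  have "0 < J"
    using c[of "h (0, 0)" "h (0, 0)" m] h[OF row] nat_self[OF hM[OF row]] by (simp add: J_def)
  \<comment> \<open>\<open>N\<close> bounds the image distance for both candidate points below. It
    also serves as the index into the sequence, since \<open>N \<le> r N\<close>.\<close>
  obtain N where N: "c' J \<le> N" "c' (Suc J) \<le> N"
    by (meson max.cobounded1 max.cobounded2)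
  have "N \<le> r N"
    using \<open>strict_mono r\<close> by (rule strict_mono_imp_increasing)
  obtain k where k: "y N = h (k, 0)"
    using \<open>range y \<subseteq> Y\<close> by (auto simp: Y_def)
  \<comment> \<open>A column of height above \<open>J\<close> contains a point at distance exactly
    \<open>J\<close> from its base. If \<open>k \<le> J\<close>, the row point
    \<open>(Suc J, 0)\<close> is at distance exactly \<open>Suc J\<close> instead.\<close>
  have "\<exists>q\<in>W2. m < d (y N) (h q) \<and> d (y N) (h q) \<le> r N"
  proof (cases "J < k")
    case True
    then have q: "(k, J) \<in> W2"
      by (simp add: W2_iff)
    have e: "rho (k, 0) (k, J) = J"
      using \<open>0 < J\<close> by (simp add: rho_def rho'_def)
    show ?thesis
      using far[OF row q, of m k] near[OF row q, of k] e N \<open>N \<le> r N\<close> q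
      by (intro bexI[of _ "(k, J)"]) (auto simp: k simp flip: J_def)
  next
    case False
    have e: "rho (k, 0) (Suc J, 0) = Suc J"
      using False by (simp add: rho_def rho'_def)
    show ?thesis
      using far[OF row row, of m k "Suc J"] near[OF row row, of k "Suc J"] e N \<open>N \<le> r N\<close> row
      by (intro bexI[of _ "(Suc J, 0)"]) (auto simp: k simp flip: J_def)
  qed
  then obtain q where "q \<in> W2" "m < d (y N) (h q)" "d (y N) (h q) \<le> r N"
    by blast
  then have "h q \<in> mcball (y N) (real (r N)) - mcball (y N) (real m)"
    using hM row by (auto simp: k)
  with iso show False
    by blast
qed

section \<open>Construction of a copy of \<open>W2\<close>\<close>

text \<open>The points \<open>x y j\<close> will form the column based at \<open>y\<close>. It
  matters that \<open>D\<close> does not depend on \<open>y\<close>, since one control function must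
  serve all columns.\<close>

lemma annulus_points:
  assumes "\<not> has_asymptotically_isolated_balls Y" "Y \<subseteq> M"
  obtains x :: "'a \<Rightarrow> nat \<Rightarrow> 'a" and D where "mono D"
    "\<And>y j. y \<in> Y \<Longrightarrow> x y j \<in> M" "\<And>y j. y \<in> Y \<Longrightarrow> d y (x y j) \<le> D j"
    "\<And>y i j. y \<in> Y \<Longrightarrow> i < j \<Longrightarrow> j \<le> d (x y i) (x y j)"
proof -
  obtain g where g: "\<And>m. m < g m"
    "\<And>m y. y \<in> Y \<Longrightarrow> \<exists>x\<in>M. m < d y x \<and> d y x \<le> g m"
    using annuli_nonempty[OF assms] by metis
  then obtain z where z: "\<And>m y. y \<in> Y \<Longrightarrow> z y m \<in> M \<and> m < d y (z y m) \<and> d y (z y m) \<le> g m"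
    by metis
  \<comment> \<open>The annulus of index \<open>Suc j\<close> starts \<open>Suc j\<close> beyond the
    outer radius \<open>g (s j)\<close> of the preceding one, so the triangle inequality through
    \<open>y\<close> yields the required separation.\<close>
  define s where "s = rec_nat 0 (\<lambda>j t. g t + Suc j)"
  have s_Suc: "s (Suc j) = g (s j) + Suc j" for j
    by (simp add: s_def)
  define D where "D j = g (s j)" for j
  have "D j \<le> D (Suc j)" for j
    using g(1)[of "s (Suc j)"] by (simp add: D_def s_Suc)
  then have D: "mono D"
    by (rule incseq_SucI)
  define x where "x y j = (if j = 0 then y else z y (s j))" for y j
  have xM: "x y j \<in> M" if "y \<in> Y" for y j
    using that z assms(2) by (auto simp: x_def)
  have xD: "d y (x y j) \<le> D j" if "y \<in> Y" for y j
    using that z[of y "s j"] assms(2) by (auto simp: x_def D_def nat_self subsetD)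
  moreover have "j \<le> d (x y i) (x y j)" if "y \<in> Y" "i < j" for y i j
  proof -
    obtain l where l: "j = Suc l" "i \<le> l"
      using \<open>i < j\<close> by (cases j) auto
    have "s j < d y (x y j)"
      using l z[OF that(1)] by (simp add: x_def)
    moreover have "d y (x y j) \<le> d y (x y i) + d (x y i) (x y j)"
      using that(1) xM assms(2) by (intro nat_triangle) auto
    moreover have "d y (x y i) \<le> D l"
      using xD[OF that(1), of i] monoD[OF D l(2)] by simp
    ultimately show ?thesis
      using l by (simp add: s_Suc D_def)
  qed
  ultimately show thesis
    using that[of D x] D xM by blast
qed

text \<open>The pair \<open>(n, j)\<close> is sent to the \<open>j\<close>-th annulus point around
  the \<open>n\<close>-th term of a sparse sequence in \<open>Y\<close>. This map never shrinks
  distances and enlarges them in a controlled way, so \<open>asymorphicI\<close> applies.\<close>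

lemma W2_if_not_scattered:
  assumes "\<not> asymptotically_scattered"
  shows "\<exists>S\<subseteq>M. asymorphic S d W2 rho"
proof -
  obtain Y where Y: "Y \<subseteq> M" "\<not> mbounded Y" "\<not> has_asymptotically_isolated_balls Y"
    using assms unfolding asymptotically_scattered_def by blast
  obtain x D where "mono D"
    and xM: "\<And>y j. y \<in> Y \<Longrightarrow> x y j \<in> M"
    and xD: "\<And>y j. y \<in> Y \<Longrightarrow> d y (x y j) \<le> D j"
    and xsep: "\<And>y i j. y \<in> Y \<Longrightarrow> i < j \<Longrightarrow> j \<le> d (x y i) (x y j)"
    using annulus_points[OF Y(3,1)] by metis
  \<comment> \<open>An empty carrier would force \<open>Y\<close> to be empty, hence
    bounded.\<close>
  obtain p where p: "p \<in> M"
    using Y(1,2) mbounded_empty by (metis ex_in_conv subsetD)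
  \<comment> \<open>Points used in columns up to \<open>n\<close> lie within \<open>D n\<close> of
    their bases. The gap \<open>2 * D n + n\<close> therefore leaves more than \<open>n\<close>
    between column \<open>n\<close> and every earlier one.\<close>
  obtain y where yY: "\<And>n. y n \<in> Y"
    and y_Suc: "\<And>n. d p (y n) + 2 * D (Suc n) + Suc n < d p (y (Suc n))"
    using dependent_nat_choice[of "\<lambda>_ a. a \<in> Y"
        "\<lambda>n a b. d p a + 2 * D (Suc n) + Suc n < d p b"]
      unbounded_far_point[OF Y(2,1) p] by blast
  have yM: "y n \<in> M" for n
    using yY Y(1) by blast
  have y_mono: "mono (\<lambda>n. d p (y n))"
    using y_Suc by (intro incseq_SucI) (metis add_leD1 less_imp_le)
  have y_sep: "d p (y k) + 2 * D n + n < d p (y n)" if "k < n" for k n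
  proof -
    obtain l where "n = Suc l" "k \<le> l"
      using \<open>k < n\<close> by (cases n) auto
    with y_Suc[of l] monoD[OF y_mono \<open>k \<le> l\<close>] show ?thesis
      by simp
  qed
  define h where "h = (\<lambda>(n, j). x (y n) j)"
  \<comment> \<open>This bounds the path from one column to another through \<open>p\<close>: two
    base distances and two column radii, each at most its value at the larger index.\<close>
  define C where "C n = 2 * d p (y n) + 2 * D n" for n
  have "mono C"
    using y_mono \<open>mono D\<close> unfolding C_def mono_def by (meson add_mono mult_le_mono2)
  have hM: "h q \<in> M" for q
    using xM yY by (cases q) (simp add: h_def)
  have column: "max i j \<le> d (x (y n) i) (x (y n) j) \<and> d (x (y n) i) (x (y n) j) \<le> C (max i j)"
    if "i < j" for n i j
  proof -
    have "d (x (y n) i) (x (y n) j) \<le> d (x (y n) i) (y n) + d (y n) (x (y n) j)"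
      using xM yM yY by (intro nat_triangle) auto
    also have "\<dots> \<le> D i + D j"
      using xD[OF yY] by (metis add_mono nat_commute)
    also have "\<dots> \<le> C j"
      using monoD[OF \<open>mono D\<close>, of i j] that by (simp add: C_def)
    finally show ?thesis
      using xsep[OF yY that] that by (simp add: max_def)
  qed
  have columns: "n \<le> d (x (y k) i) (x (y n) j) \<and> d (x (y k) i) (x (y n) j) \<le> C n"
    if "k < n" "i \<le> k" "j \<le> n" for k n i j
  proof -
    let ?a = "x (y k) i" and ?b = "x (y n) j"
    have M: "?a \<in> M" "?b \<in> M"
      using xM yY by auto
    have "i \<le> n"
      using that by simp
    then have a: "d (y k) ?a \<le> D n"
      using xD[OF yY, of k i] monoD[OF \<open>mono D\<close>] le_trans by blast
    have b: "d (y n) ?b \<le> D n"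
      using xD[OF yY, of n j] monoD[OF \<open>mono D\<close> that(3)] by simp
    have pa: "d p ?a \<le> d p (y k) + d (y k) ?a" and pb: "d p ?b \<le> d p (y n) + d (y n) ?b"
      and pn: "d p (y n) \<le> d p ?b + d (y n) ?b" and pab: "d p ?b \<le> d p ?a + d ?a ?b"
      and ab: "d ?a ?b \<le> d p ?a + d p ?b"
      using nat_triangle p M yM nat_commute by metis+
    show ?thesis
      using a b pa pb pn pab ab y_sep[OF that(1)] by (simp add: C_def)
  qed
  have bounds: "rho q q' \<le> d (h q) (h q') \<and> d (h q) (h q') \<le> C (rho q q')"
    if W: "q \<in> W2" "q' \<in> W2" for q q'
  proof -
    obtain n i k j where q: "q = (n, i)" "q' = (k, j)"
      by (cases q, cases q')
    with W have ij: "i \<le> n" "j \<le> k" "i = 0 \<or> i < n" "j = 0 \<or> j < k"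
      by (auto simp: W2_iff)
    show ?thesis
    proof (cases n k rule: linorder_cases)
      case equal
      show ?thesis
      proof (cases i j rule: linorder_cases)
        case less
        with column[of i j n] equal ij show ?thesis
          by (simp add: q h_def rho_same_column rho'_def)
      next
        case greater
        with column[of j i n] equal ij show ?thesis
          by (simp add: q h_def rho_same_column rho'_def max.commute nat_commute)
      qed (use equal nat_self[OF hM[of q]] in \<open>simp add: q rho_same_column rho'_def\<close>)
    next
      case less
      with columns[of n k i j] ij rho_distinct_columns[of n i k j] W show ?thesis
        by (simp add: q h_def)
    next
      case greater
      with columns[of k n j i] ij rho_distinct_columns[of n i k j] W show ?thesis
        by (simp add: q h_def nat_commute)
    qed
  qed
  \<comment> \<open>Injectivity comes from the lower bound: equal images force
    \<open>rho q q'\<close> to vanish.\<close>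
  have "inj_on h W2"
  proof (rule inj_onI)
    fix q q'
    assume "q \<in> W2" "q' \<in> W2" "h q = h q'"
    then have "rho q q' \<le> 0"
      using bounds[of q q'] nat_self[OF hM[of q']] by simp
    then show "q = q'"
      by (auto simp: rho_def rho'_def prod_eq_iff split: if_splits)
  qed
  then have "asymorphic (h ` W2) d W2 rho"
    using bounds \<open>mono C\<close> by (intro asymorphicI[where C = C]) blast+
  moreover have "h ` W2 \<subseteq> M"
    using hM by blast
  ultimately show ?thesis
    by blast
qed

end

theorem theorem3:
  fixes X :: "'a set" and d :: "'a \<Rightarrow> 'a \<Rightarrow> nat"
  assumes "nat_metric_space X d"
  shows "nat_metric_space.asymptotically_scattered X d \<longleftrightarrow>
           \<not> (\<exists>S\<subseteq>X. asymorphic S d W2 rho)"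
  using nat_metric_space.not_scattered_if_W2[OF assms]
    nat_metric_space.W2_if_not_scattered[OF assms] by blast

end
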